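(* Let $f:(0,\tfrac12)\to\mathbb{R}$ be the relative efficiency of the sequential probability ratio test for the drift of a Brownian motion with symmetric error bound $\alpha$, i.e. $$f(\alpha)=\frac{\mathbb{E}_1[\tau_\alpha]}{T_\alpha}=\frac{\eta(\alpha)}{\left(\Phi^{-1}(\alpha)\right)^2},\qquad \eta(\alpha)=\frac{1-2\alpha}{2}\ln\frac{1-\alpha}{\alpha}.$$ Then $f$ is increasing on $(0,\tfrac12)$, with $\lim_{\alpha\downarrow 0}f(\alpha)=\frac14$ and $\lim_{\alpha\uparrow 1/2}f(\alpha)=\frac{2}{\pi}$.
   Context: $\Phi(x)=\int_{-\infty}^x\varphi(y)\,dy$ and $\varphi(y)=\frac{1}{\sqrt{2\pi}}e^{-y^2/2}$ are the distribution function and density of the standard normal distribution, and $\Phi^{-1}:(0,1)\to\mathbb{R}$ is the inverse of $\Phi$. Let $X_t=\theta t+W_t$ with $W$ a standard Brownian motion, $W_0=0$, and let $\mathbb{P}_a$ (with expectation $\mathbb{E}_a$), $a\in\{-1,1\}$, be the probability measure under which $\theta=a$. One tests $H_1:\theta=1$ against $H_{-1}:\theta=-1$, requiring both error probabilities to be at most $\alpha\in(0,\frac12)$. The smallest deterministic sample size achieving this is $T_\alpha=(\Phi^{-1}(\alpha))^2$. The sequential probability ratio test uses $$\tau_\alpha=\inf\left\{t\ge 0: X_t\notin\left(\tfrac12\ln\tfrac{\alpha}{1-\alpha},\tfrac12\ln\tfrac{1-\alpha}{\alpha}\right)\right\},$$ and by classical results $\mathbb{E}_{-1}[\tau_\alpha]=\mathbb{E}_1[\tau_\alpha]=\eta(\alpha)$.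 Hence $f$ may be taken to be defined by $f(\alpha)=\eta(\alpha)/(\Phi^{-1}(\alpha))^2$. *)

theory Defs
  imports "HOL-Probability.Probability"
begin

definition Phi :: "real \<Rightarrow> real" where
  "Phi x = (LBINT y:{..x}. std_normal_density y)"

(* Phi is injective with range (0,1), so inv Phi is its genuine inverse on (0,1);
   outside (0,1) the value is unspecified. *)
definition Phi_inv :: "real \<Rightarrow> real" where
  "Phi_inv = inv Phi"

(* Smallest deterministic sample size for which both errors are at most \<alpha>. *)
definition T_fixed :: "real \<Rightarrow> real" where
  "T_fixed \<alpha> = (Phi_inv \<alpha>)\<^sup>2"

(* Common expected sample size of the sequential probability ratio test under
   drift 1 and drift -1 (the expectation of \<tau>_\<alpha>), in closed form. *)
definition eta :: "real \<Rightarrow> real" where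
  "eta \<alpha> = (1 - 2 * \<alpha>) / 2 * ln ((1 - \<alpha>) / \<alpha>)"

definition rel_eff :: "real \<Rightarrow> real" where
  "rel_eff \<alpha> = eta \<alpha> / T_fixed \<alpha>"

end

theory Submission
  imports Defs "HOL-Real_Asymp.Real_Asymp"
begin

text \<open>
  Put \<open>m = 1 - 2 * \<alpha>\<close> and \<open>x = Phi_inv \<alpha>\<close>, so that \<open>eta \<alpha> = m * artanh m\<close>. Then
  the relative efficiency is the product of \<open>m * artanh m / (- ln (1 - m\<^sup>2))\<close> and
  \<open>- ln (1 - m\<^sup>2) / x\<^sup>2\<close>. The first factor is strictly decreasing in \<open>m\<close>, because the
  quotient of the derivatives of numerator and denominator is (monotone l'Hopital rule).
  For the second factor, \<open>1 - m\<^sup>2 = 4 * Phi x * (1 - Phi x)\<close> is, by the classical polar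
  coordinate computation for the Gaussian integral, a mixture of exponentials
  \<open>exp (- x\<^sup>2 * y)\<close> over a probability distribution of \<open>y\<close>; Jensen's inequality
  (monotonicity of power means) shows that \<open>- ln (1 - m\<^sup>2) / x\<^sup>2\<close> decreases in \<open>x\<^sup>2\<close>.
\<close>

section \<open>The normal distribution function\<close>

lemma Phi_eq_cdf: "Phi = cdf std_normal_distribution"
proof
  fix x :: real
  have "cdf std_normal_distribution x
      = (LINT y|std_normal_distribution. indicator {..x} y)"
    by (simp add: cdf_def)
  also have "\<dots> = (LINT y|lborel. std_normal_density y *\<^sub>R indicator {..x} y)"
    by (rule integral_density) (auto simp: normal_density_nonneg)
  also have "\<dots> = Phi x"
    by (simp add: Phi_def set_lebesgue_integral_def mult.commute)
  finally show "Phi x = cdf std_normal_distribution x" ..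
qed

lemma Phi_tendsto_at_top: "(Phi \<longlongrightarrow> 1) at_top"
  unfolding Phi_eq_cdf
  by (rule real_distribution.cdf_lim_at_top_prob[OF real_dist_normal_dist])

lemma Phi_tendsto_at_bot: "(Phi \<longlongrightarrow> 0) at_bot"
  unfolding Phi_eq_cdf
  using finite_borel_measure.cdf_lim_at_bot
    real_distribution.finite_borel_measure_M[OF real_dist_normal_dist] by blast

lemma continuous_on_std_normal_density: "continuous_on A std_normal_density"
  unfolding std_normal_density_def by (intro continuous_intros) auto

text \<open>Turns the Lebesgue integral over a half-line into a constant plus an integral over a
  compact interval, the form to which the fundamental theorem of calculus applies.\<close>

lemma Phi_eq_add_integral:
  assumes "a \<le> y"
  shows "Phi y = Phi a + integral {a..y} std_normal_density"
proof -
  have int: "set_integrable lborel A std_normal_density" if "A \<in> sets borel" for A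
    using integrable_mult_indicator[of A lborel std_normal_density] that
    by (auto simp: set_integrable_def)
  have eq: "{..y} = {..a} \<union> {a<..y}" using assms by auto
  have "Phi y = Phi a + (LBINT u:{a<..y}. std_normal_density u)"
    unfolding Phi_def eq by (rule set_integral_Un) (auto intro!: int)
  also have "(LBINT u:{a<..y}. std_normal_density u) = integral {a<..y} std_normal_density"
    by (rule set_borel_integral_eq_integral) (auto intro!: int)
  also have "\<dots> = integral {a..y} std_normal_density"
  proof (rule integral_spike_set)
    show "negligible {x \<in> {a<..y} - {a..y}. std_normal_density x \<noteq> 0}"
      by (rule negligible_subset[of "{}"]) auto
    show "negligible {x \<in> {a..y} - {a<..y}. std_normal_density x \<noteq> 0}"
      by (rule negligible_subset[of "{a}"]) auto
  qed
  finally show ?thesis .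
qed

lemma has_real_derivative_Phi: "(Phi has_real_derivative std_normal_density x) (at x)"
proof -
  have "((\<lambda>y. Phi (x - 1) + integral {x - 1..y} std_normal_density)
      has_real_derivative 0 + std_normal_density x) (at x within {x - 1..x + 1})"
    by (intro derivative_intros integral_has_real_derivative continuous_on_std_normal_density) auto
  moreover have "at x within {x - 1..x + 1} = at x"
    by (rule at_within_interior) simp
  ultimately have "((\<lambda>y. Phi (x - 1) + integral {x - 1..y} std_normal_density)
      has_real_derivative std_normal_density x) (at x)" by simp
  then show ?thesis
  proof (rule has_field_derivative_transform_within_open)
    show "open {x - 1<..}" "x \<in> {x - 1<..}" by auto
  qed (simp add: Phi_eq_add_integral[of "x - 1", symmetric])
qed

lemma has_real_derivative_Phi_comp [derivative_intros]:
  assumes "(g has_real_derivative D) (at x within A)"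
  shows "((\<lambda>x. Phi (g x)) has_real_derivative std_normal_density (g x) * D) (at x within A)"
  using DERIV_chain2[OF has_real_derivative_Phi assms] .

lemma strict_mono_Phi: "strict_mono Phi"
proof (rule strict_monoI)
  fix x y :: real assume "x < y"
  then show "Phi x < Phi y"
    by (rule DERIV_pos_imp_increasing)
      (use has_real_derivative_Phi normal_density_pos[of 1 0] in \<open>auto intro!: exI\<close>)
qed

text \<open>The density is even, so \<open>Phi x + Phi (- x)\<close> has derivative 0 and is
  constant; its value at 0 is compared with its limit at infinity.\<close>

lemma Phi_0: "Phi 0 = 1/2"
proof -
  have "((\<lambda>x. Phi x + Phi (- x)) has_real_derivative 0) (at x)" for x
    by (auto intro!: derivative_eq_intros simp: std_normal_density_def)
  then have const: "Phi x + Phi (- x) = 2 * Phi 0" for x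
    using DERIV_isconst_all[of "\<lambda>x. Phi x + Phi (- x)" x 0] by simp
  have "((\<lambda>x. Phi x + Phi (- x)) \<longlongrightarrow> 1 + 0) at_top"
    by (intro tendsto_add Phi_tendsto_at_top filterlim_compose[OF Phi_tendsto_at_bot]
        filterlim_uminus_at_bot_at_top)
  then have "((\<lambda>x::real. 2 * Phi 0) \<longlongrightarrow> 1 + 0) at_top"
    by (simp only: const)
  from tendsto_unique[OF trivial_limit_at_top_linorder tendsto_const this]
  show ?thesis by simp
qed

section \<open>The quantile function on the lower half and its limits\<close>

lemma Phi_inv_Phi: "Phi_inv (Phi x) = x"
  unfolding Phi_inv_def using strict_mono_Phi by (simp add: strict_mono_imp_inj_on)

lemma Phi_surj_lower_half:
  assumes "0 < \<alpha>" "\<alpha> < 1/2"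
  obtains y where "y < 0" "Phi y = \<alpha>"
proof -
  have "\<forall>\<^sub>F x in at_bot. Phi x < \<alpha> \<and> x \<le> 0"
    using order_tendstoD(2)[OF Phi_tendsto_at_bot assms(1)] eventually_le_at_bot[of 0]
    by eventually_elim auto
  from eventually_happens[OF this] obtain a where a: "Phi a < \<alpha>" "a \<le> 0"
    by auto
  have "\<exists>y\<ge>a. y \<le> 0 \<and> Phi y = \<alpha>"
    by (rule IVT) (use a assms Phi_0 has_real_derivative_Phi DERIV_isCont in auto)
  then obtain y where "y \<le> 0" "Phi y = \<alpha>" by auto
  moreover from this have "y \<noteq> 0" using Phi_0 assms by auto
  ultimately show ?thesis using that[of y] by simp
qed

lemma Phi_inv_works:
  assumes "0 < \<alpha>" "\<alpha> < 1/2"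
  shows "Phi (Phi_inv \<alpha>) = \<alpha>" "Phi_inv \<alpha> < 0"
proof -
  obtain y where "y < 0" "Phi y = \<alpha>"
    using Phi_surj_lower_half[OF assms] .
  then show "Phi (Phi_inv \<alpha>) = \<alpha>" "Phi_inv \<alpha> < 0"
    using Phi_inv_Phi[of y] by simp_all
qed

lemma eventually_lower_half:
  "\<forall>\<^sub>F \<alpha>::real in at_right 0. 0 < \<alpha> \<and> \<alpha> < 1/2"
  "\<forall>\<^sub>F \<alpha>::real in at_left (1/2). 0 < \<alpha> \<and> \<alpha> < 1/2"
  by (auto intro: eventually_at_rightI[of 0 "1/2"] eventually_at_leftI[of 0])

lemma Phi_inv_at_bot: "filterlim Phi_inv at_bot (at_right 0)"
  unfolding filterlim_at_bot
proof
  fix K :: real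
  \<comment> \<open>Strict monotonicity from \<open>K - 1\<close> to \<open>K\<close> upgrades
    nonnegativity to \<open>Phi K > 0\<close>, so that the points below \<open>Phi K\<close> form a
    right neighbourhood of 0.\<close>
  have "Phi (K - 1) \<ge> 0"
    by (simp add: Phi_eq_cdf cdf_def)
  then have "Phi K > 0" using strict_monoD[OF strict_mono_Phi, of "K - 1" K] by simp
  then have "\<forall>\<^sub>F \<alpha> in at_right 0. \<alpha> < Phi K"
    by (auto intro: eventually_at_rightI[of 0 "Phi K"])
  then show "\<forall>\<^sub>F \<alpha> in at_right 0. Phi_inv \<alpha> \<le> K"
    using eventually_lower_half(1)
  proof eventually_elim
    case (elim \<alpha>)
    then show ?case
      using Phi_inv_works[of \<alpha>] strict_mono_less[OF strict_mono_Phi, of "Phi_inv \<alpha>" K] by simp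
  qed
qed

text \<open>The target is the punctured filter \<open>at 0\<close>, so that the difference quotient
  of \<open>Phi\<close> at 0 can be composed with \<open>Phi_inv\<close>.\<close>

lemma Phi_inv_at_half: "filterlim Phi_inv (at 0) (at_left (1/2))"
proof (rule filterlim_atI)
  show "\<forall>\<^sub>F \<alpha> in at_left (1/2). Phi_inv \<alpha> \<noteq> 0"
    using eventually_lower_half(2) by eventually_elim (use Phi_inv_works in fastforce)
  show "(Phi_inv \<longlongrightarrow> 0) (at_left (1/2))"
  proof (rule order_tendstoI)
    fix a :: real assume "a < 0"
    then have "Phi a < 1/2" using strict_monoD[OF strict_mono_Phi, of a 0] Phi_0 by simp
    then have "\<forall>\<^sub>F \<alpha> in at_left (1/2). \<alpha> > Phi a"
      by (auto intro: eventually_at_leftI[of "Phi a"])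
    then show "\<forall>\<^sub>F \<alpha> in at_left (1/2). a < Phi_inv \<alpha>"
      using eventually_lower_half(2)
      by eventually_elim
        (metis Phi_inv_works(1) strict_mono_less strict_mono_Phi)
  next
    fix a :: real assume "0 < a"
    then show "\<forall>\<^sub>F \<alpha> in at_left (1/2). Phi_inv \<alpha> < a"
      using eventually_lower_half(2) by (auto elim!: eventually_mono dest: Phi_inv_works(2))
  qed
qed

section \<open>The error product as a mixture of exponentials\<close>

text \<open>The Laplace transform of \<open>(1 + t^2) / 2\<close> when \<open>t\<close> has density
  \<open>4 / (pi * (1 + t^2))\<close> on [0,1]. In terms of Owen's T function,
  \<open>mix (h^2)\<close> is 8 T(h,1).\<close>

definition mix :: "real \<Rightarrow> real" where
  "mix s = 4 / pi * integral {0..1} (\<lambda>t. exp (- s * (1 + t\<^sup>2) / 2) / (1 + t\<^sup>2))"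

lemma one_plus_square_neq_0: "1 + t\<^sup>2 \<noteq> (0::real)"
  using zero_le_power2[of t] by linarith

lemma continuous_on_mix_integrand:
  "continuous_on A (\<lambda>t::real. exp (- s * (1 + t\<^sup>2) / 2) / (1 + t\<^sup>2))"
  by (intro continuous_intros) (auto simp: one_plus_square_neq_0)

lemma integrable_mix_integrand:
  "(\<lambda>t::real. exp (- s * (1 + t\<^sup>2) / 2) / (1 + t\<^sup>2)) integrable_on {a..b}"
  by (intro integrable_continuous_interval continuous_on_mix_integrand)

lemma has_integral_arctan: "((\<lambda>t::real. 1 / (1 + t\<^sup>2)) has_integral pi / 4) {0..1}"
proof -
  have "((\<lambda>t::real. 1 / (1 + t\<^sup>2)) has_integral arctan 1 - arctan 0) {0..1}"
    by (rule fundamental_theorem_of_calculus)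
      (auto simp: has_real_derivative_iff_has_vector_derivative[symmetric] divide_inverse
        intro!: derivative_eq_intros)
  then show ?thesis by (simp add: arctan_one)
qed

lemma mix_0: "mix 0 = 1"
  using integral_unique[OF has_integral_arctan] by (simp add: mix_def)

text \<open>Differentiating under the integral sign cancels the denominator \<open>1 + t^2\<close>.
  The remaining exponential splits into \<open>exp (- x^2 / 2)\<close> and a Gaussian in
  \<open>x * t\<close>.\<close>

lemma has_real_derivative_mix_square:
  "((\<lambda>x. mix (x\<^sup>2)) has_real_derivative 4 * std_normal_density x * (1 - 2 * Phi x)) (at x)"
proof -
  \<comment> \<open>An antiderivative in \<open>t\<close> is
    \<open>sqrt (2 * pi) * Phi (x * t)\<close>, whatever the sign of \<open>x\<close>.\<close>
  have "((\<lambda>t. exp (- (x * t)\<^sup>2 / 2) * x) has_integral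
      sqrt (2 * pi) * Phi (x * 1) - sqrt (2 * pi) * Phi (x * 0)) {0..1}"
    by (rule fundamental_theorem_of_calculus)
      (auto simp: has_real_derivative_iff_has_vector_derivative[symmetric] std_normal_density_def
        intro!: derivative_eq_intros)
  from has_integral_mult_right[OF this, of "- exp (- x\<^sup>2 / 2)"]
  have "((\<lambda>t. - exp (- x\<^sup>2 / 2) * (exp (- (x * t)\<^sup>2 / 2) * x)) has_integral
      - exp (- x\<^sup>2 / 2) * (sqrt (2 * pi) * (Phi x - 1/2))) {0..1}"
    by (simp add: Phi_0 algebra_simps)
  also have "(\<lambda>t. - exp (- x\<^sup>2 / 2) * (exp (- (x * t)\<^sup>2 / 2) * x))
      = (\<lambda>t. - x * exp (- x\<^sup>2 * (1 + t\<^sup>2) / 2))"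
    by (simp add: fun_eq_iff exp_add[symmetric] power_mult_distrib field_simps)
  finally have I: "integral {0..1} (\<lambda>t. - x * exp (- x\<^sup>2 * (1 + t\<^sup>2) / 2))
      = - exp (- x\<^sup>2 / 2) * (sqrt (2 * pi) * (Phi x - 1/2))"
    by (rule integral_unique)
  have "((\<lambda>x. integral (cbox 0 1) (\<lambda>t. exp (- x\<^sup>2 * (1 + t\<^sup>2) / 2) / (1 + t\<^sup>2)))
      has_field_derivative integral (cbox 0 1) (\<lambda>t. - x * exp (- x\<^sup>2 * (1 + t\<^sup>2) / 2)))
      (at x within UNIV)"
  proof (rule leibniz_rule_field_derivative)
    fix y t :: real
    show "((\<lambda>x. exp (- x\<^sup>2 * (1 + t\<^sup>2) / 2) / (1 + t\<^sup>2)) has_real_derivative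
      - y * exp (- y\<^sup>2 * (1 + t\<^sup>2) / 2)) (at y within UNIV)"
      using one_plus_square_neq_0[of t]
      by (auto intro!: derivative_eq_intros simp: divide_simps)
  next
    show "continuous_on (UNIV \<times> cbox 0 1) (\<lambda>(x, t). - x * exp (- x\<^sup>2 * (1 + t\<^sup>2) / 2) :: real)"
      unfolding split_beta by (intro continuous_intros) auto
  qed (use integrable_mix_integrand in \<open>auto simp: cbox_interval\<close>)
  from DERIV_cmult[OF this, of "4 / pi"]
  have "((\<lambda>x. mix (x\<^sup>2)) has_real_derivative
      4 / pi * (- exp (- x\<^sup>2 / 2) * (sqrt (2 * pi) * (Phi x - 1/2)))) (at x)"
    unfolding mix_def cbox_interval I .
  moreover have "4 / pi * (- exp (- x\<^sup>2 / 2) * (sqrt (2 * pi) * (Phi x - 1/2)))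
      = 4 * std_normal_density x * (1 - 2 * Phi x)"
  proof -
    have "sqrt (2 * pi) / pi = 2 / sqrt (2 * pi)"
      by (simp add: field_simps)
    moreover have "4 / pi * (- exp (- x\<^sup>2 / 2) * (sqrt (2 * pi) * (Phi x - 1/2)))
      = 4 * (sqrt (2 * pi) / pi) * (- exp (- x\<^sup>2 / 2) * (Phi x - 1/2))"
      by simp
    ultimately have "4 / pi * (- exp (- x\<^sup>2 / 2) * (sqrt (2 * pi) * (Phi x - 1/2)))
      = 4 * (2 / sqrt (2 * pi)) * (- exp (- x\<^sup>2 / 2) * (Phi x - 1/2))"
      by (simp only:)
    then show ?thesis by (simp add: std_normal_density_def field_simps)
  qed
  ultimately show ?thesis by simp
qed

text \<open>Both sides have the same derivative in \<open>x\<close> and the value 1 at 0.\<close>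

lemma Phi_product_eq_mix: "4 * Phi x * (1 - Phi x) = mix (x\<^sup>2)"
proof -
  have "((\<lambda>x. mix (x\<^sup>2) - 4 * Phi x * (1 - Phi x)) has_real_derivative 0) (at x)" for x
    by (rule derivative_eq_intros has_real_derivative_mix_square has_real_derivative_Phi refl)+
      (simp add: algebra_simps)
  then have "mix (x\<^sup>2) - 4 * Phi x * (1 - Phi x) = mix (0\<^sup>2) - 4 * Phi 0 * (1 - Phi 0)"
    using DERIV_isconst_all[of "\<lambda>x. mix (x\<^sup>2) - 4 * Phi x * (1 - Phi x)" x 0] by blast
  then show ?thesis by (simp add: mix_0 Phi_0)
qed

section \<open>Exponential bounds and positivity of the mixture\<close>

lemma mix_le_exp:
  assumes "s \<ge> 0"
  shows "mix s \<le> exp (- s / 2)"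
proof -
  have "integral {0..1} (\<lambda>t. exp (- s * (1 + t\<^sup>2) / 2) / (1 + t\<^sup>2)) \<le> exp (- s / 2) * (pi / 4)"
  proof (rule has_integral_le[OF integrable_integral[OF integrable_mix_integrand]
        has_integral_mult_right[OF has_integral_arctan]])
    fix t :: real
    have "- s * (1 + t\<^sup>2) / 2 \<le> - s / 2" using assms by (simp add: field_simps)
    then have "exp (- s * (1 + t\<^sup>2) / 2) / (1 + t\<^sup>2) \<le> exp (- s / 2) / (1 + t\<^sup>2)"
      by (intro divide_right_mono) auto
    then show "exp (- s * (1 + t\<^sup>2) / 2) / (1 + t\<^sup>2) \<le> exp (- s / 2) * (1 / (1 + t\<^sup>2))" by simp
  qed
  then show ?thesis by (simp add: mix_def field_simps)
qed

text \<open>Only \<open>t \<le> 1 / s\<close> is kept: there the exponent is within \<open>1 / (2 * s)\<close> of its maximum,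
  at the cost of a factor of order \<open>1 / s\<close>.\<close>

lemma mix_ge:
  assumes "s \<ge> 1"
  shows "mix s \<ge> 2 / (pi * s) * exp (- s / 2 - 1 / (2 * s))"
proof -
  let ?c = "exp (- s / 2 - 1 / (2 * s)) / 2"
  have "integral {0..1/s} (\<lambda>t. ?c) \<le> integral {0..1/s} (\<lambda>t. exp (- s * (1 + t\<^sup>2) / 2) / (1 + t\<^sup>2))"
  proof (rule integral_le)
    show "exp (- s / 2 - 1 / (2 * s)) / 2 \<le> exp (- s * (1 + t\<^sup>2) / 2) / (1 + t\<^sup>2)"
      if "t \<in> {0..1/s}" for t
    proof (rule frac_le)
      have t2: "t\<^sup>2 \<le> (1/s)\<^sup>2" using that by (intro power_mono) auto
      then have "s * t\<^sup>2 \<le> s * (1/s)\<^sup>2" using assms by (intro mult_left_mono) auto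
      then have "s * t\<^sup>2 \<le> 1 / s" using assms by (simp add: power2_eq_square)
      then show "exp (- s / 2 - 1 / (2 * s)) \<le> exp (- s * (1 + t\<^sup>2) / 2)"
        using assms by (simp add: algebra_simps add_divide_distrib)
      have "(1/s)\<^sup>2 \<le> 1" using assms by (simp add: power_le_one)
      with t2 show "1 + t\<^sup>2 \<le> 2" by simp
      show "0 < 1 + t\<^sup>2" using zero_le_power2[of t] by linarith
    qed auto
  qed (rule integrable_mix_integrand integrable_const_ivl)+
  also have "\<dots> \<le> integral {0..1} (\<lambda>t. exp (- s * (1 + t\<^sup>2) / 2) / (1 + t\<^sup>2))"
    by (intro integral_subset_le integrable_mix_integrand) (use assms in auto)
  finally have "integral {0..1/s} (\<lambda>t. ?c)
      \<le> integral {0..1} (\<lambda>t. exp (- s * (1 + t\<^sup>2) / 2) / (1 + t\<^sup>2))" .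
  then show ?thesis using assms by (simp add: mix_def field_simps)
qed

lemma mix_pos: "mix s > 0"
proof -
  \<comment> \<open>On [0,1], \<open>1 + t^2\<close> is at most 2: this bounds both the size of the
    exponent and the denominator.\<close>
  let ?c = "exp (- \<bar>s\<bar>) / 2"
  have "?c = integral {0..1::real} (\<lambda>t. ?c)"
    by simp
  also have "\<dots> \<le> integral {0..1} (\<lambda>t. exp (- s * (1 + t\<^sup>2) / 2) / (1 + t\<^sup>2))"
  proof (rule integral_le)
    fix t :: real assume t: "t \<in> {0..1}"
    then have t2: "t\<^sup>2 \<le> 1" by (simp add: power_le_one)
    show "?c \<le> exp (- s * (1 + t\<^sup>2) / 2) / (1 + t\<^sup>2)"
    proof (rule frac_le)
      have "\<bar>s * (1 + t\<^sup>2)\<bar> \<le> \<bar>s\<bar> * 2"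
        unfolding abs_mult using t2 by (intro mult_left_mono) auto
      then show "exp (- \<bar>s\<bar>) \<le> exp (- s * (1 + t\<^sup>2) / 2)" by simp
      show "0 < 1 + t\<^sup>2" using zero_le_power2[of t] by linarith
    qed (use t2 in auto)
  qed (use integrable_mix_integrand in auto)
  finally have "0 < integral {0..1} (\<lambda>t. exp (- s * (1 + t\<^sup>2) / 2) / (1 + t\<^sup>2))"
    using exp_gt_zero[of "- \<bar>s\<bar>"] by linarith
  then show ?thesis
    unfolding mix_def by (intro mult_pos_pos) auto
qed

lemma ln_mix_le:
  assumes "s \<ge> 0"
  shows "ln (mix s) \<le> - s / 2"
proof -
  have "ln (mix s) \<le> ln (exp (- s / 2))"
    using mix_le_exp[OF assms] mix_pos[of s] by (subst ln_le_cancel_iff) auto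
  then show ?thesis by simp
qed

section \<open>Jensen's inequality and the logarithmic decay rate of the mixture\<close>

text \<open>Convexity of \<open>exp\<close> between 0 and \<open>u\<close>, since
  \<open>a * u\<close> is the point with weights \<open>1 - a\<close> and \<open>a\<close>.\<close>

lemma exp_mult_le_convex:
  fixes a u :: real
  assumes "0 \<le> a" "a \<le> 1"
  shows "exp (a * u) \<le> 1 - a + a * exp u"
proof -
  \<comment> \<open>The tangent bound \<open>1 + v <= exp v\<close> is applied to the displacements
    of \<open>u\<close> and 0 from \<open>a * u\<close>; their weighted sum is zero, so the linear
    terms cancel.\<close>
  have "1 \<le> a * (1 + (1 - a) * u) + (1 - a) * (1 + - a * u)"
    by (simp add: algebra_simps)
  also have "\<dots> \<le> a * exp ((1 - a) * u) + (1 - a) * exp (- a * u)"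
    using assms by (intro add_mono mult_left_mono exp_ge_add_one_self) auto
  finally have "exp (a * u) * 1 \<le> exp (a * u) * (a * exp ((1 - a) * u) + (1 - a) * exp (- a * u))"
    by (intro mult_left_mono) auto
  also have "\<dots> = 1 - a + a * exp u"
    by (simp add: distrib_left mult.left_commute[of "exp _"] exp_add[symmetric] algebra_simps)
  finally show ?thesis by simp
qed

text \<open>Equivalent to \<open>mix s <= mix r powr (s / r)\<close>: a power mean inequality with
  exponent \<open>a = s / r\<close> at most 1.\<close>

lemma ln_mix_div_antimono:
  assumes "0 < s" "s \<le> r"
  shows "- ln (mix r) / r \<le> - ln (mix s) / s"
proof -
  define a A where "a = s / r" and "A = mix r"
  have a: "0 \<le> a" "a \<le> 1" "a * r = s" and A: "A > 0"
    using assms mix_pos by (auto simp: a_def A_def)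
  let ?e = "\<lambda>s t::real. exp (- s * (1 + t\<^sup>2) / 2) / (1 + t\<^sup>2)"
  have "integral {0..1} (?e s)
      \<le> exp (a * ln A) * ((1 - a) * (pi / 4) + a / A * integral {0..1} (?e r))"
  proof (rule has_integral_le)
    show "(?e s has_integral integral {0..1} (?e s)) {0..1}"
      by (intro integrable_integral integrable_mix_integrand)
    show "((\<lambda>t. exp (a * ln A) * ((1 - a) * (1 / (1 + t\<^sup>2)) + a / A * ?e r t)) has_integral
        exp (a * ln A) * ((1 - a) * (pi / 4) + a / A * integral {0..1} (?e r))) {0..1}"
      by (intro has_integral_mult_right has_integral_add has_integral_arctan
          integrable_integral integrable_mix_integrand)
    fix t :: real
    define Y where "Y = (1 + t\<^sup>2) / 2"
    \<comment> \<open>Dividing by \<open>A = mix r\<close> gives \<open>exp (- r * Y) / A\<close>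
      mean 1 under the mixing distribution, so the convexity bound averages to exactly
      \<open>1 - a + a = 1\<close>.\<close>
    have "exp (- s * Y) = exp (a * ln A) * exp (a * (- r * Y - ln A))"
      using a(3) by (auto simp: exp_add[symmetric] algebra_simps)
    also have "\<dots> \<le> exp (a * ln A) * (1 - a + a * exp (- r * Y - ln A))"
      by (intro mult_left_mono exp_mult_le_convex a) auto
    also have "exp (- r * Y - ln A) = exp (- r * Y) / A"
      using A by (simp add: exp_diff)
    finally have "exp (- s * Y) / (1 + t\<^sup>2) \<le> exp (a * ln A) * (1 - a + a * (exp (- r * Y) / A)) / (1 + t\<^sup>2)"
      by (rule divide_right_mono) auto
    then show "?e s t \<le> exp (a * ln A) * ((1 - a) * (1 / (1 + t\<^sup>2)) + a / A * ?e r t)"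
      by (simp add: Y_def algebra_simps add_divide_distrib diff_divide_distrib)
  qed
  also have "integral {0..1} (?e r) = pi / 4 * A"
    by (simp add: A_def mix_def)
  also have "(1 - a) * (pi / 4) + a / A * (pi / 4 * A) = pi / 4"
    using A by (simp add: field_simps)
  finally have "mix s \<le> exp (a * ln A)"
    by (simp add: mix_def field_simps)
  then have "ln (mix s) \<le> a * ln A"
    using mix_pos[of s] by (simp add: ln_le_cancel_iff[symmetric] del: ln_le_cancel_iff)
  then show ?thesis
    using assms by (simp add: a_def A_def field_simps)
qed

text \<open>Upper and lower bounds for \<open>mix s\<close> share the rate
  \<open>exp (- s / 2)\<close>; the remaining factors contribute only a logarithmic term and a
  vanishing one, which disappear after division by \<open>s\<close>.\<close>

lemma ln_mix_div_tendsto: "((\<lambda>s. - ln (mix s) / s) \<longlongrightarrow> 1/2) at_top"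
proof (rule tendsto_sandwich)
  show "\<forall>\<^sub>F s in at_top. 1/2 \<le> - ln (mix s) / s"
    using eventually_gt_at_top[of 0]
  proof eventually_elim
    case (elim s)
    then show ?case using ln_mix_le[of s] by (simp add: field_simps)
  qed
  show "\<forall>\<^sub>F s in at_top. - ln (mix s) / s \<le> - ln (2 / (pi * s) * exp (- s / 2 - 1 / (2 * s))) / s"
    using eventually_ge_at_top[of 1]
  proof eventually_elim
    case (elim s)
    have "ln (2 / (pi * s) * exp (- s / 2 - 1 / (2 * s))) \<le> ln (mix s)"
      using mix_ge[of s] mix_pos[of s] elim by (subst ln_le_cancel_iff) auto
    then show ?case using elim by (simp add: divide_right_mono)
  qed
  show "((\<lambda>s. - ln (2 / (pi * s) * exp (- s / 2 - 1 / (2 * s))) / s) \<longlongrightarrow> 1/2) at_top"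
    by real_asymp
qed auto

section \<open>The factor depending on the error level alone\<close>

lemma less_artanh:
  assumes "0 < x" "x < 1"
  shows "x < artanh (x::real)"
proof -
  have "artanh 0 - 0 < artanh x - x"
  proof (rule DERIV_pos_imp_increasing_open[OF assms(1)])
    fix y :: real assume y: "0 < y" "y < x"
    then have "y\<^sup>2 < 1" using assms by (simp add: abs_square_less_1)
    then have "1 / (1 - y\<^sup>2) - 1 > 0" using y by (simp add: field_simps)
    moreover have "((\<lambda>y. artanh y - y) has_real_derivative 1 / (1 - y\<^sup>2) - 1) (at y)"
      using y assms by (auto intro!: derivative_eq_intros)
    ultimately show "\<exists>D. ((\<lambda>y. artanh y - y) has_real_derivative D) (at y) \<and> 0 < D" by blast
  qed (use assms in \<open>auto intro!: continuous_intros\<close>)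
  then show ?thesis by simp
qed

text \<open>Up to an increasing affine map, this function is the quotient of derivatives needed for
  the monotone l'Hopital rule below. The sign of its derivative comes from
  \<open>z < artanh z\<close>.\<close>

lemma artanh_mult_div_strict_antimono:
  assumes "0 < x" "x < y" "y < (1::real)"
  shows "(1 - y\<^sup>2) * artanh y / y < (1 - x\<^sup>2) * artanh x / x"
proof (rule DERIV_neg_imp_decreasing[OF assms(2)])
  fix z assume z: "x \<le> z" "z \<le> y"
  with assms have z01: "0 < z" "z < 1" by auto
  then have z2: "z\<^sup>2 < 1" by (simp add: abs_square_less_1)
  let ?D = "(z - (1 + z\<^sup>2) * artanh z) / z\<^sup>2"
  have "((\<lambda>z. (1 - z\<^sup>2) * artanh z / z) has_real_derivative ?D) (at z)"
    using z01 z2 by (auto intro!: derivative_eq_intros simp: field_simps power2_eq_square)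
  moreover have "z < (1 + z\<^sup>2) * artanh z"
    using less_artanh[OF z01] z01 by (smt (verit) mult_le_cancel_right1 zero_le_power2)
  then have "?D < 0" using z01 by (simp add: divide_neg_pos)
  ultimately show "\<exists>D. ((\<lambda>z. (1 - z\<^sup>2) * artanh z / z) has_real_derivative D) (at z) \<and> D < 0"
    by blast
qed

lemma artanh_ratio_strict_antimono:
  assumes "0 < x" "x < y" "y < (1::real)"
  shows "y * artanh y / (- ln (1 - y\<^sup>2)) < x * artanh x / (- ln (1 - x\<^sup>2))"
proof (rule DERIV_neg_imp_decreasing[OF assms(2)])
  fix z assume z: "x \<le> z" "z \<le> y"
  define h k h' k' where "h = (\<lambda>z::real. z * artanh z)" and "k = (\<lambda>z::real. - ln (1 - z\<^sup>2))"
    and "h' = (\<lambda>z::real. artanh z + z / (1 - z\<^sup>2))" and "k' = (\<lambda>z::real. 2 * z / (1 - z\<^sup>2))"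
  from z assms have z01: "0 < z" "z < 1" by auto
  have sq: "u\<^sup>2 < 1" if "0 \<le> u" "u < 1" for u :: real
    using that by (simp add: abs_square_less_1)
  have h: "(h has_real_derivative h' u) (at u)" if "0 \<le> u" "u < 1" for u
    unfolding h_def h'_def using that by (auto intro!: derivative_eq_intros)
  have k: "(k has_real_derivative k' u) (at u)" if "0 \<le> u" "u < 1" for u
    unfolding k_def k'_def using that sq[OF that] by (auto intro!: derivative_eq_intros)
  \<comment> \<open>Cauchy's mean value theorem on [0,z]; as \<open>h\<close> and \<open>k\<close>
    vanish at 0, it identifies \<open>h z / k z\<close> with \<open>h' c / k' c\<close> at an
    earlier point \<open>c\<close>.\<close>
  have "\<exists>c. 0 < c \<and> c < z \<and> (h z - h 0) * k' c = (k z - k 0) * h' c"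
    by (rule GMVT') (use z01 in \<open>auto intro: h k DERIV_isCont[OF h] DERIV_isCont[OF k]\<close>)
  then obtain c where c: "0 < c" "c < z" "h z * k' c = k z * h' c"
    by (auto simp: h_def k_def)
  have k'_pos: "k' u > 0" if "0 < u" "u < 1" for u
    using that sq[of u] by (simp add: k'_def)
  have ratio: "h' u / k' u = ((1 - u\<^sup>2) * artanh u / u + 1) / 2" if "0 < u" "u < 1" for u
    using that sq[of u] by (simp add: h'_def k'_def field_simps)
  have k_pos: "k z > 0"
    using z01 sq[of z] by (simp add: k_def)
  have "c < 1" using c z01 by simp
  have "h' z / k' z < h' c / k' c"
    unfolding ratio[OF z01] ratio[OF c(1) \<open>c < 1\<close>]
    using artanh_mult_div_strict_antimono[OF c(1,2) z01(2)]
    by (intro divide_strict_right_mono add_strict_right_mono) auto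
  also have "\<dots> = h z / k z"
    using c(3) k'_pos[of c] k_pos c z01 by (simp add: field_simps)
  \<comment> \<open>This is negativity of the numerator in the quotient rule for
    \<open>h / k\<close>.\<close>
  finally have "h' z * k z < h z * k' z"
    using k_pos k'_pos[OF z01] by (simp add: field_simps)
  then have "(h' z * k z - h z * k' z) / (k z * k z) < 0"
    using k_pos by (simp add: divide_neg_pos)
  moreover have "((\<lambda>z. h z / k z) has_real_derivative (h' z * k z - h z * k' z) / (k z * k z)) (at z)"
    using k_pos z01 by (intro DERIV_divide h k) auto
  ultimately show "\<exists>D. ((\<lambda>z. z * artanh z / (- ln (1 - z\<^sup>2))) has_real_derivative D) (at z) \<and> D < 0"
    unfolding h_def k_def by blast
qed

section \<open>Relative efficiency\<close>

lemma eta_eq_artanh: "eta \<alpha> = (1 - 2 * \<alpha>) * artanh (1 - 2 * \<alpha>)"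
proof -
  have "(1 + (1 - 2 * \<alpha>)) / (1 - (1 - 2 * \<alpha>)) = (1 - \<alpha>) / \<alpha>"
    \<comment> \<open>At \<alpha> = 0 both denominators are 0, and both quotients are 0 by the
      convention for division by zero.\<close>
    by (cases "\<alpha> = 0") (auto simp: field_simps)
  then show ?thesis by (simp add: eta_def artanh_def)
qed

lemma error_product_eq_mix:
  assumes "0 < \<alpha>" "\<alpha> < 1/2"
  shows "1 - (1 - 2 * \<alpha>)\<^sup>2 = mix ((Phi_inv \<alpha>)\<^sup>2)"
  using Phi_product_eq_mix[of "Phi_inv \<alpha>"] Phi_inv_works[OF assms]
  by (simp add: power2_eq_square algebra_simps)

lemma rel_eff_factorization:
  assumes "0 < \<alpha>" "\<alpha> < 1/2"
  shows "rel_eff \<alpha> = eta \<alpha> / (- ln (1 - (1 - 2 * \<alpha>)\<^sup>2))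
    * (- ln (mix ((Phi_inv \<alpha>)\<^sup>2)) / (Phi_inv \<alpha>)\<^sup>2)"
proof -
  \<comment> \<open>These bounds make the logarithm nonzero; the two factors contain the same
    logarithm, which then cancels.\<close>
  have "0 < (1 - 2 * \<alpha>)\<^sup>2" "(1 - 2 * \<alpha>)\<^sup>2 < 1"
    using assms by (auto simp: abs_square_less_1)
  then have "ln (1 - (1 - 2 * \<alpha>)\<^sup>2) < 0" by simp
  then show ?thesis
    unfolding rel_eff_def T_fixed_def error_product_eq_mix[OF assms, symmetric] by simp
qed

lemma rel_eff_strict_mono: "strict_mono_on {0<..<1/2} rel_eff"
proof (rule strict_mono_onI)
  fix \<alpha> \<beta> :: real
  assume "\<alpha> \<in> {0<..<1/2}" "\<beta> \<in> {0<..<1/2}" and less: "\<alpha> < \<beta>"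
  then have \<alpha>: "0 < \<alpha>" "\<alpha> < 1/2" and \<beta>: "0 < \<beta>" "\<beta> < 1/2" by auto
  note inv = Phi_inv_works[OF \<alpha>] Phi_inv_works[OF \<beta>]
  have "Phi_inv \<alpha> < Phi_inv \<beta>"
    using inv less strict_mono_less[OF strict_mono_Phi] by metis
  \<comment> \<open>Both quantiles are negative, so squaring reverses their order.\<close>
  then have "(Phi_inv \<beta>)\<^sup>2 \<le> (Phi_inv \<alpha>)\<^sup>2"
    using inv by (simp add: abs_le_square_iff[symmetric])
  then have 1: "- ln (mix ((Phi_inv \<alpha>)\<^sup>2)) / (Phi_inv \<alpha>)\<^sup>2
      \<le> - ln (mix ((Phi_inv \<beta>)\<^sup>2)) / (Phi_inv \<beta>)\<^sup>2"
    using inv by (intro ln_mix_div_antimono) auto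
  have 2: "eta \<alpha> / (- ln (1 - (1 - 2 * \<alpha>)\<^sup>2)) < eta \<beta> / (- ln (1 - (1 - 2 * \<beta>)\<^sup>2))"
    unfolding eta_eq_artanh using \<alpha> \<beta> less by (intro artanh_ratio_strict_antimono) auto
  have 3: "0 < - ln (mix ((Phi_inv \<alpha>)\<^sup>2)) / (Phi_inv \<alpha>)\<^sup>2"
  proof -
    have "0 < (Phi_inv \<alpha>)\<^sup>2" using inv by auto
    then show ?thesis
      using ln_mix_le[of "(Phi_inv \<alpha>)\<^sup>2"] by (intro divide_pos_pos) linarith+
  qed
  have 4: "0 \<le> eta \<beta> / (- ln (1 - (1 - 2 * \<beta>)\<^sup>2))"
  proof -
    have "(1 - 2 * \<beta>)\<^sup>2 < 1" using \<beta> by (auto simp: abs_square_less_1)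
    then have "ln (1 - (1 - 2 * \<beta>)\<^sup>2) \<le> 0" by (simp add: ln_le_zero_iff)
    moreover have "eta \<beta> \<ge> 0"
      unfolding eta_eq_artanh using less_artanh[of "1 - 2 * \<beta>"] \<beta> by simp
    ultimately show ?thesis by (intro divide_nonneg_nonneg) auto
  qed
  \<comment> \<open>The first factor is replaced strictly, against a positive second factor at
    \<alpha>; then the second is replaced weakly, against a nonnegative first factor at
    \<beta>.\<close>
  show "rel_eff \<alpha> < rel_eff \<beta>"
    unfolding rel_eff_factorization[OF \<alpha>] rel_eff_factorization[OF \<beta>]
    using mult_strict_right_mono[OF 2 3] mult_left_mono[OF 1 4] by linarith
qed

section \<open>Limits at the two ends of the interval\<close>

text \<open>Each factor tends to 1/2: one by the decay rate of \<open>mix\<close>, the other because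
  \<open>eta\<close> behaves like half of \<open>- ln \<alpha>\<close> and its denominator like
  \<open>- ln \<alpha>\<close>.\<close>

lemma rel_eff_tendsto_0: "(rel_eff \<longlongrightarrow> 1/4) (at_right 0)"
proof -
  have "filterlim (\<lambda>\<alpha>. (Phi_inv \<alpha>)\<^sup>2) at_top (at_right 0)"
    by (rule filterlim_compose[OF _ Phi_inv_at_bot]) real_asymp
  from filterlim_compose[OF ln_mix_div_tendsto this]
  have "((\<lambda>\<alpha>. - ln (mix ((Phi_inv \<alpha>)\<^sup>2)) / (Phi_inv \<alpha>)\<^sup>2) \<longlongrightarrow> 1/2) (at_right 0)" .
  moreover have "((\<lambda>\<alpha>. eta \<alpha> / (- ln (1 - (1 - 2 * \<alpha>)\<^sup>2))) \<longlongrightarrow> 1/2) (at_right 0)"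
    unfolding eta_def by real_asymp
  ultimately have "((\<lambda>\<alpha>. eta \<alpha> / (- ln (1 - (1 - 2 * \<alpha>)\<^sup>2))
      * (- ln (mix ((Phi_inv \<alpha>)\<^sup>2)) / (Phi_inv \<alpha>)\<^sup>2)) \<longlongrightarrow> 1/2 * (1/2)) (at_right 0)"
    by (intro tendsto_mult)
  then have "(rel_eff \<longlongrightarrow> 1/2 * (1/2)) (at_right 0)"
    by (rule Lim_transform_eventually)
      (use eventually_lower_half(1) rel_eff_factorization in \<open>auto elim!: eventually_mono\<close>)
  then show ?thesis by simp
qed

text \<open>Here the splitting is through \<open>m^2\<close> with
  \<open>m = 1 - 2 * \<alpha>\<close>: \<open>eta \<alpha> / m^2\<close> tends to 1, and
  \<open>m^2 / x^2\<close> is 4 times the squared difference quotient of \<open>Phi\<close> at 0,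
  where \<open>x = Phi_inv \<alpha>\<close>.\<close>

lemma rel_eff_tendsto_half: "(rel_eff \<longlongrightarrow> 2/pi) (at_left (1/2))"
proof -
  have "((\<lambda>y. (Phi y - Phi 0) / (y - 0)) \<longlongrightarrow> std_normal_density 0) (at 0)"
    using has_real_derivative_Phi[of 0] by (simp add: has_field_derivative_iff)
  from filterlim_compose[OF this Phi_inv_at_half]
  have "((\<lambda>\<alpha>. (Phi (Phi_inv \<alpha>) - 1/2) / Phi_inv \<alpha>) \<longlongrightarrow> std_normal_density 0) (at_left (1/2))"
    by (simp add: Phi_0)
  then have 1: "((\<lambda>\<alpha>. 4 * ((Phi (Phi_inv \<alpha>) - 1/2) / Phi_inv \<alpha>)\<^sup>2)
      \<longlongrightarrow> 4 * (std_normal_density 0)\<^sup>2) (at_left (1/2))"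
    by (intro tendsto_intros)
  have 2: "((\<lambda>\<alpha>. eta \<alpha> / (1 - 2 * \<alpha>)\<^sup>2) \<longlongrightarrow> 1) (at_left (1/2))"
    unfolding eta_def by real_asymp
  have "((\<lambda>\<alpha>. eta \<alpha> / (1 - 2 * \<alpha>)\<^sup>2 * (4 * ((Phi (Phi_inv \<alpha>) - 1/2) / Phi_inv \<alpha>)\<^sup>2))
      \<longlongrightarrow> 1 * (4 * (std_normal_density 0)\<^sup>2)) (at_left (1/2))"
    by (rule tendsto_mult[OF 2 1])
  moreover have "1 * (4 * (std_normal_density 0)\<^sup>2) = 2 / pi"
    by (simp add: std_normal_density_def power_divide)
  moreover have "\<forall>\<^sub>F \<alpha> in at_left (1/2). eta \<alpha> / (1 - 2 * \<alpha>)\<^sup>2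
      * (4 * ((Phi (Phi_inv \<alpha>) - 1/2) / Phi_inv \<alpha>)\<^sup>2) = rel_eff \<alpha>"
    using eventually_lower_half(2)
  proof eventually_elim
    case (elim \<alpha>)
    then have "(1 - 2 * \<alpha>)\<^sup>2 \<noteq> 0" by simp
    moreover have "4 * (\<alpha> - 1/2)\<^sup>2 = (1 - 2 * \<alpha>)\<^sup>2"
      by (simp add: power2_eq_square algebra_simps)
    ultimately show ?case
      using elim Phi_inv_works(1)[of \<alpha>] by (simp add: rel_eff_def T_fixed_def power_divide)
  qed
  ultimately show ?thesis
    using Lim_transform_eventually by force
qed

theorem theorem3p1:
  shows "strict_mono_on {0<..<1/2} rel_eff
    \<and> (rel_eff \<longlongrightarrow> 1/4) (at_right 0)
    \<and> (rel_eff \<longlongrightarrow> 2/pi) (at_left (1/2))"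
  using rel_eff_strict_mono rel_eff_tendsto_0 rel_eff_tendsto_half by blast

end
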